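(* Let $V,\Lambda,K,\mu_o>0$ and put $$\bar L_o=\max\Big\{L>0:\ \frac{L^3}{1+L}\le\frac{2\Lambda^2}{K\mu_o^2}\Big\},\qquad \bar K=\frac{2\Lambda^2\sqrt{V\Lambda+1}}{\mu_o^2(\sqrt{V\Lambda+1}-1)^3},\qquad \overline{C}_o=\frac{\bar L_o(3+\bar L_o)}{2\Lambda}.$$ In the single-service model with on-demand service only (System O), the optimal policy of the service provider is characterized by the following effective arrival rate $\lambda_o^O$, average number of customers in the system $L_o^O=\lambda_o^OW_o^O$, and optimal profit $\pi^O$: $$\lambda_o^O=\Lambda,\quad L_o^O=\bar L_o,\quad \pi^O=\Lambda(V-\overline{C}_o)\qquad\text{if }K\ge\bar K,$$ $$\lambda_o^O=\frac{K}{\bar K}\Lambda,\quad L_o^O=\sqrt{V\Lambda+1}-1,\quad \pi^O=\frac{K\mu_o^2(\sqrt{V\Lambda+1}-1)^4}{4\Lambda^2}\qquad\text{otherwise.}$$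
   Context: System O. Customers arrive at rate $\Lambda>0$. Each customer has a type $\theta$, uniform on $[0,1]$, and joins the service if and only if $U_o=V-p_o-\theta W_o\ge 0$, where $V>0$ is the service value, $p_o$ the price and $W_o$ the lead time. The service provider (SP) chooses the price $p_o$ and a per-service wage $w_o$. There is a pool of $K>0$ potential contractors, each with service rate $\mu_o>0$, with reservation rates $r$ uniform on $[0,1]$; a contractor participates iff her hourly earning $\lambda_ow_o/k_o$ is at least $r$, where $k_o$ is the (real) number of participating contractors. Thus $$\lambda_o=\Lambda\Pr(U_o\ge0),\qquad W_o=\frac1{k_o\mu_o-\lambda_o}\ (k_o\mu_o>\lambda_o),\qquad k_o=K\Pr\Big(\frac{\lambda_ow_o}{k_o}\ge r\Big),$$ where the uniform distribution function is taken to be $x\mapsto x$, so that the last condition reads $k_o^2=K\lambda_ow_o$. The SP maximizes $p_o\lambda_o-\lambda_ow_o$ over all $(p_o,w_o)$ with corresponding $(\lambda_o,W_o,k_o)$ satisfying these relations; the optimal value is $\pi^O$. *)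

theory Defs
  imports "HOL-Probability.Probability"
begin

record policy =
  price :: real
  wage :: real
  arrival_rate :: real
  lead_time :: real
  contractors :: real

definition utility :: "real \<Rightarrow> policy \<Rightarrow> real \<Rightarrow> real" where
  "utility V x \<theta> = V - price x - \<theta> * lead_time x"

(* The last condition is contractors = K * F (arrival_rate * wage / contractors)
   with F the identity: participation is not capped at the pool size K.  Customer
   types, in contrast, have the genuine uniform law, so arrival_rate is at most
   \<Lambda>.  Negative prices are allowed. *)
definition feasible :: "real \<Rightarrow> real \<Rightarrow> real \<Rightarrow> real \<Rightarrow> policy \<Rightarrow> bool" where
  "feasible V \<Lambda> K \<mu> x \<longleftrightarrow>
     arrival_rate x =
       \<Lambda> * \<P>(\<theta> in uniform_measure lborel {0..1}. utility V x \<theta> \<ge> 0) \<and>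
     contractors x * \<mu> > arrival_rate x \<and>
     lead_time x = 1 / (contractors x * \<mu> - arrival_rate x) \<and>
     (contractors x)\<^sup>2 = K * arrival_rate x * wage x"

definition profit :: "policy \<Rightarrow> real" where
  "profit x = price x * arrival_rate x - arrival_rate x * wage x"

definition optimal :: "real \<Rightarrow> real \<Rightarrow> real \<Rightarrow> real \<Rightarrow> policy \<Rightarrow> bool" where
  "optimal V \<Lambda> K \<mu> x \<longleftrightarrow>
     feasible V \<Lambda> K \<mu> x \<and> (\<forall>y. feasible V \<Lambda> K \<mu> y \<longrightarrow> profit y \<le> profit x)"

definition optimal_profit :: "real \<Rightarrow> real \<Rightarrow> real \<Rightarrow> real \<Rightarrow> real" where
  "optimal_profit V \<Lambda> K \<mu> = (SUP x \<in> {x. feasible V \<Lambda> K \<mu> x}. profit x)"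

definition avg_customers :: "policy \<Rightarrow> real" where
  "avg_customers x = arrival_rate x * lead_time x"

definition L_bar :: "real \<Rightarrow> real \<Rightarrow> real \<Rightarrow> real" where
  "L_bar \<Lambda> K \<mu> = (GREATEST L. L > 0 \<and> L ^ 3 / (1 + L) \<le> 2 * \<Lambda>\<^sup>2 / (K * \<mu>\<^sup>2))"

definition K_bar :: "real \<Rightarrow> real \<Rightarrow> real \<Rightarrow> real" where
  "K_bar V \<Lambda> \<mu> =
     2 * \<Lambda>\<^sup>2 * sqrt (V * \<Lambda> + 1) / (\<mu>\<^sup>2 * (sqrt (V * \<Lambda> + 1) - 1) ^ 3)"

definition C_bar :: "real \<Rightarrow> real \<Rightarrow> real \<Rightarrow> real" where
  "C_bar \<Lambda> K \<mu> = L_bar \<Lambda> K \<mu> * (3 + L_bar \<Lambda> K \<mu>) / (2 * \<Lambda>)"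

end

theory Submission
  imports Defs
begin

text \<open>In terms of the served fraction \<open>x = \<lambda>/\<Lambda>\<close> and the number \<open>L = \<lambda> W\<close> of customers in the
  system, a feasible policy earns at most
  \<open>x (V \<Lambda> - L) - c x\<^sup>2 (1 + 1/L)\<^sup>2\<close> with \<open>c = \<Lambda>\<^sup>2/(K \<mu>\<^sup>2)\<close>, and exactly one policy attains this for
  given \<open>(x, L)\<close>. Writing \<open>V \<Lambda> = s\<^sup>2 - 1\<close>, the bound is \<open>y g(L) - c y\<^sup>2\<close> with \<open>y = x (1 + 1/L)\<close> and
  \<open>g(L) = s\<^sup>2 + 1 - (1 + L) - s\<^sup>2/(1 + L) \<le> (s - 1)\<^sup>2\<close>, so two completed squares give the global
  maximum, at \<open>L = s - 1\<close>. This maximizer has \<open>x < 1\<close> exactly when \<open>K\<close> is below the threshold.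
  Above the threshold, replace \<open>V \<Lambda>\<close> by the smaller value \<open>(1 + L)\<^sup>2 - 1\<close>, \<open>L\<close> being \<open>L_bar\<close>, for
  which the unconstrained maximizer is \<open>x = 1\<close>; the remaining part of the profit is increasing in
  \<open>x\<close>, hence also maximal at \<open>x = 1\<close>.\<close>

lemma prob_uniform_01_atMost:
  fixes a :: real
  shows "\<P>(\<theta> in uniform_measure lborel {0..1}. \<theta> \<le> a) = max 0 (min 1 a)"
proof -
  have "\<P>(\<theta> in uniform_measure lborel {0..1}. \<theta> \<le> a) = measure lborel ({0..1} \<inter> {..a})"
    by (simp add: measure_uniform_measure atMost_def)
  also have "{0..1} \<inter> {..a} = {0..min 1 a}" by auto
  finally show ?thesis by (simp add: max_def)
qed

lemma prob_utility_nonneg: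
  assumes "lead_time x > 0"
  shows "\<P>(\<theta> in uniform_measure lborel {0..1}. utility V x \<theta> \<ge> 0)
           = max 0 (min 1 ((V - price x) / lead_time x))"
proof -
  have "utility V x \<theta> \<ge> 0 \<longleftrightarrow> \<theta> \<le> (V - price x) / lead_time x" for \<theta>
    using assms by (simp add: utility_def field_simps)
  then show ?thesis by (simp only: prob_uniform_01_atMost)
qed

section \<open>Maximization of the reduced profit in two variables\<close>

text \<open>Revenue minus wage bill: by the participation equation the wage bill is k^2/K, which
  becomes the squared term. \<open>D\<close> is a free argument because both
  \<open>V * \<Lambda>\<close> and s^2 - 1 are substituted for it.\<close>

definition reduced_profit :: "real \<Rightarrow> real \<Rightarrow> real \<Rightarrow> real \<Rightarrow> real" where
  "reduced_profit D c x L = x * (D - L) - c * (x * (1 + 1 / L))\<^sup>2"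

lemma reduced_profit_le:
  assumes "c > 0" "s > 1" "x > 0" "L > 0"
  shows "reduced_profit (s\<^sup>2 - 1) c x L \<le> (s - 1) ^ 4 / (4 * c)"
    and "reduced_profit (s\<^sup>2 - 1) c x L = (s - 1) ^ 4 / (4 * c) \<longleftrightarrow>
           L = s - 1 \<and> x = (s - 1) ^ 3 / (2 * c * s)"
proof -
  define y where "y = x * (1 + 1 / L)"
  have "y > 0" using assms by (simp add: y_def add_pos_pos)
  have "1 + L \<noteq> 0" using assms by simp
  moreover have "y = x * ((1 + L) / L)" using assms by (simp add: y_def field_simps)
  ultimately have x: "x = y * (L / (1 + L))" using assms by simp
  \<comment> \<open>First square: (1 + L) + s^2/(1 + L) - 2 s = (1 + L - s)^2/(1 + L).\<close>
  have "x * (s\<^sup>2 - 1 - L) = y * (s - 1)\<^sup>2 - y * ((1 + L - s)\<^sup>2 / (1 + L))"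
    using assms by (simp add: x field_simps power2_eq_square)
  moreover have "(s - 1) ^ 4 / (4 * c) - (y * (s - 1)\<^sup>2 - c * y\<^sup>2) = ((s - 1)\<^sup>2 - 2 * c * y)\<^sup>2 / (4 * c)"
  proof -
    have e: "(s - 1) ^ 4 = ((s - 1)\<^sup>2)\<^sup>2" by simp
    show ?thesis unfolding e using assms by (simp add: field_simps power2_diff) (simp add: power2_eq_square algebra_simps)
  qed
  ultimately have eq: "(s - 1) ^ 4 / (4 * c) - reduced_profit (s\<^sup>2 - 1) c x L =
      ((s - 1)\<^sup>2 - 2 * c * y)\<^sup>2 / (4 * c) + y * ((1 + L - s)\<^sup>2 / (1 + L))"
    unfolding reduced_profit_def y_def [symmetric] by linarith
  have nonneg: "((s - 1)\<^sup>2 - 2 * c * y)\<^sup>2 / (4 * c) \<ge> 0" "y * ((1 + L - s)\<^sup>2 / (1 + L)) \<ge> 0"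
    using assms \<open>y > 0\<close> by simp_all
  then show "reduced_profit (s\<^sup>2 - 1) c x L \<le> (s - 1) ^ 4 / (4 * c)" using eq by linarith
  have "reduced_profit (s\<^sup>2 - 1) c x L = (s - 1) ^ 4 / (4 * c) \<longleftrightarrow>
      ((s - 1)\<^sup>2 - 2 * c * y)\<^sup>2 / (4 * c) = 0 \<and> y * ((1 + L - s)\<^sup>2 / (1 + L)) = 0"
    using eq nonneg by linarith
  also have "\<dots> \<longleftrightarrow> L = s - 1 \<and> (s - 1)\<^sup>2 = 2 * c * y"
    using assms \<open>y > 0\<close> by auto
  also have "\<dots> \<longleftrightarrow> L = s - 1 \<and> x = (s - 1) ^ 3 / (2 * c * s)"
  \<comment> \<open>At L = s - 1 one has y = x s/(s - 1), so multiplying by s - 1 turns the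
    condition on y into one on x.\<close>
  proof (rule conj_cong [OF refl])
    assume L: "L = s - 1"
    have y: "y * (s - 1) = x * s" using assms(2) by (simp add: y_def L field_simps)
    have "(s - 1)\<^sup>2 = 2 * c * y \<longleftrightarrow> (s - 1)\<^sup>2 * (s - 1) = 2 * c * (y * (s - 1))"
      using assms(2) by (simp flip: mult.assoc)
    also have "\<dots> \<longleftrightarrow> (s - 1) ^ 3 = 2 * c * s * x"
      unfolding y by (simp add: power3_eq_cube power2_eq_square mult_ac)
    also have "\<dots> \<longleftrightarrow> x = (s - 1) ^ 3 / (2 * c * s)"
      using assms by (auto simp add: field_simps)
    finally show "(s - 1)\<^sup>2 = 2 * c * y \<longleftrightarrow> x = (s - 1) ^ 3 / (2 * c * s)" .
  qed
  finally show "reduced_profit (s\<^sup>2 - 1) c x L = (s - 1) ^ 4 / (4 * c) \<longleftrightarrow>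
      L = s - 1 \<and> x = (s - 1) ^ 3 / (2 * c * s)" .
qed

section \<open>Feasible policies versus pairs (x, L)\<close>

text \<open>The price leaves type x indifferent, since L/\<Lambda> = x W. The contractors solve W =
  1/(k \<mu> - \<lambda>), and the wage then solves k^2 = K \<lambda> w.\<close>

definition induced_policy :: "real \<Rightarrow> real \<Rightarrow> real \<Rightarrow> real \<Rightarrow> real \<Rightarrow> real \<Rightarrow> policy" where
  "induced_policy V \<Lambda> K \<mu> x L =
     \<lparr>price = V - L / \<Lambda>,
      wage = \<Lambda> * x * (1 + 1 / L)\<^sup>2 / (K * \<mu>\<^sup>2),
      arrival_rate = \<Lambda> * x,
      lead_time = L / (\<Lambda> * x),
      contractors = \<Lambda> * x * (1 + 1 / L) / \<mu>\<rparr>"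

lemma induced_policy_simps [simp]:
  "price (induced_policy V \<Lambda> K \<mu> x L) = V - L / \<Lambda>"
  "wage (induced_policy V \<Lambda> K \<mu> x L) = \<Lambda> * x * (1 + 1 / L)\<^sup>2 / (K * \<mu>\<^sup>2)"
  "arrival_rate (induced_policy V \<Lambda> K \<mu> x L) = \<Lambda> * x"
  "lead_time (induced_policy V \<Lambda> K \<mu> x L) = L / (\<Lambda> * x)"
  "contractors (induced_policy V \<Lambda> K \<mu> x L) = \<Lambda> * x * (1 + 1 / L) / \<mu>"
  by (simp_all add: induced_policy_def)

lemma feasible_induced_policy:
  assumes "\<Lambda> > 0" "K > 0" "\<mu> > 0" "0 < x" "x \<le> 1" "L > 0"
  shows "feasible V \<Lambda> K \<mu> (induced_policy V \<Lambda> K \<mu> x L)"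
proof -
  have "lead_time (induced_policy V \<Lambda> K \<mu> x L) > 0" using assms by simp
  from prob_utility_nonneg [OF this, of V] show ?thesis
    using assms by (simp add: feasible_def field_simps power2_eq_square)
qed

lemma profit_induced_policy:
  assumes "\<Lambda> > 0"
  shows "profit (induced_policy V \<Lambda> K \<mu> x L) = reduced_profit (V * \<Lambda>) (\<Lambda>\<^sup>2 / (K * \<mu>\<^sup>2)) x L"
  using assms by (simp add: profit_def reduced_profit_def power_mult_distrib)
    (simp add: algebra_simps power2_eq_square)

text \<open>Given \<open>x\<close> and \<open>L\<close>, the lead-time and participation equations
  fix everything but the price. Demand only bounds the price from above, because at x = 1 a lower
  price attracts nobody new; raising it to the bound gains profit at rate
  \<open>arrival_rate y\<close>.\<close>

lemma feasibleD:
  assumes "\<Lambda> > 0" "K > 0" "\<mu> > 0" and y: "feasible V \<Lambda> K \<mu> y"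
  defines "x \<equiv> arrival_rate y / \<Lambda>" and "L \<equiv> avg_customers y"
  shows "0 < x" "x \<le> 1" "0 < L"
    and "profit y \<le> reduced_profit (V * \<Lambda>) (\<Lambda>\<^sup>2 / (K * \<mu>\<^sup>2)) x L"
    and "profit y = reduced_profit (V * \<Lambda>) (\<Lambda>\<^sup>2 / (K * \<mu>\<^sup>2)) x L \<Longrightarrow>
           y = induced_policy V \<Lambda> K \<mu> x L"
proof -
  define a where "a = arrival_rate y"
  define W where "W = lead_time y"
  define k where "k = contractors y"
  have gap: "k * \<mu> > a" and W: "W = 1 / (k * \<mu> - a)" and w: "k\<^sup>2 = K * a * wage y"
    using y by (simp_all add: feasible_def a_def W_def k_def)
  have Wpos: "W > 0" using gap W by simp
  have a: "a = \<Lambda> * max 0 (min 1 ((V - price y) / W))"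
    using y prob_utility_nonneg [of y V] Wpos by (simp add: feasible_def a_def W_def)
  then have "a \<ge> 0" using assms(1) by simp
  \<comment> \<open>Without arrivals the participation equation forces k = 0, contradicting the
    strict capacity condition.\<close>
  moreover have "a \<noteq> 0" using gap w assms(3) by auto
  ultimately have apos: "a > 0" by simp
  show xpos: "0 < x" using apos assms(1) by (simp add: x_def a_def)
  have x: "x = max 0 (min 1 ((V - price y) / W))" using a assms(1) by (simp add: x_def a_def)
  then show "x \<le> 1" by simp
  show Lpos: "0 < L" using apos Wpos by (simp add: L_def avg_customers_def a_def W_def)
  have ax: "a = \<Lambda> * x" using assms(1) by (simp add: x_def a_def)
  have WL: "W = L / (\<Lambda> * x)"
    using apos by (simp add: L_def avg_customers_def W_def flip: ax a_def)
  have "x \<le> (V - price y) / W" using x xpos by linarith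
  then have price: "price y \<le> V - L / \<Lambda>"
    using Wpos xpos assms(1) by (simp add: pos_le_divide_eq) (simp add: WL field_simps)
  have "k * \<mu> - a = 1 / W" by (simp add: W)
  also have "\<dots> = \<Lambda> * x / L" by (simp add: WL)
  finally have "k * \<mu> - a = \<Lambda> * x / L" .
  then have k: "k = \<Lambda> * x * (1 + 1 / L) / \<mu>" using assms(3) ax by (simp add: field_simps)
  have "wage y = k\<^sup>2 / (K * a)" using w apos assms(2) by simp
  also have "\<dots> = \<Lambda> * x * (1 + 1 / L)\<^sup>2 / (K * \<mu>\<^sup>2)"
    using assms(1-3) xpos by (simp add: k ax power_mult_distrib power_divide) (simp add: power2_eq_square mult_ac)
  finally have wage: "wage y = \<Lambda> * x * (1 + 1 / L)\<^sup>2 / (K * \<mu>\<^sup>2)" .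
  have diff: "reduced_profit (V * \<Lambda>) (\<Lambda>\<^sup>2 / (K * \<mu>\<^sup>2)) x L - profit y = a * (V - L / \<Lambda> - price y)"
    unfolding profit_induced_policy [OF assms(1), symmetric]
    by (simp add: profit_def wage ax [unfolded a_def] a_def) (simp add: algebra_simps)
  show "profit y \<le> reduced_profit (V * \<Lambda>) (\<Lambda>\<^sup>2 / (K * \<mu>\<^sup>2)) x L"
    using diff price apos mult_nonneg_nonneg [of a "V - L / \<Lambda> - price y"] by linarith
  assume "profit y = reduced_profit (V * \<Lambda>) (\<Lambda>\<^sup>2 / (K * \<mu>\<^sup>2)) x L"
  then have "price y = V - L / \<Lambda>" using diff apos by simp
  with wage ax WL k show "y = induced_policy V \<Lambda> K \<mu> x L"
    by (simp add: induced_policy_def a_def W_def k_def)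
qed

text \<open>The parameter \<open>s\<close> is \<open>sqrt (V * \<Lambda> + 1)\<close> below the threshold and \<open>1 + L_bar \<Lambda> K \<mu>\<close> above it.\<close>

lemma optimal_characterization:
  fixes V \<Lambda> K \<mu> s :: real
  assumes pos: "\<Lambda> > 0" "K > 0" "\<mu> > 0" and "s > 1"
  defines "c \<equiv> \<Lambda>\<^sup>2 / (K * \<mu>\<^sup>2)"
  defines "X \<equiv> (s - 1) ^ 3 / (2 * c * s)"
  defines "P \<equiv> (s - 1) ^ 4 / (4 * c) + X * (V * \<Lambda> - (s\<^sup>2 - 1))"
  assumes "X \<le> 1" and D: "s\<^sup>2 - 1 \<le> V * \<Lambda>" and slack: "X = 1 \<or> s\<^sup>2 - 1 = V * \<Lambda>"
  shows "(\<exists>!x. optimal V \<Lambda> K \<mu> x) \<and>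
         (\<forall>x. optimal V \<Lambda> K \<mu> x \<longleftrightarrow>
            feasible V \<Lambda> K \<mu> x \<and> arrival_rate x = X * \<Lambda> \<and> avg_customers x = s - 1 \<and> profit x = P) \<and>
         optimal_profit V \<Lambda> K \<mu> = P"
proof -
  have "c > 0" using pos by (simp add: c_def)
  have "X > 0" using \<open>c > 0\<close> \<open>s > 1\<close> by (simp add: X_def)
  define z where "z = induced_policy V \<Lambda> K \<mu> X (s - 1)"
  have split: "reduced_profit (V * \<Lambda>) c x L = reduced_profit (s\<^sup>2 - 1) c x L + x * (V * \<Lambda> - (s\<^sup>2 - 1))"
    for x L by (simp add: reduced_profit_def algebra_simps)
  have z_feasible: "feasible V \<Lambda> K \<mu> z"
    using feasible_induced_policy pos \<open>X > 0\<close> \<open>X \<le> 1\<close> \<open>s > 1\<close> by (simp add: z_def)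
  have z_profit: "profit z = P"
    using profit_induced_policy [OF pos(1), of V K \<mu> X "s - 1"] split
      reduced_profit_le(2) [OF \<open>c > 0\<close> \<open>s > 1\<close> \<open>X > 0\<close>, of "s - 1"] \<open>s > 1\<close>
    by (simp add: z_def P_def X_def c_def)
  have bound: "profit y \<le> P \<and> (profit y = P \<longrightarrow> y = z)" if y: "feasible V \<Lambda> K \<mu> y" for y
  proof -
    define x where "x = arrival_rate y / \<Lambda>"
    define L where "L = avg_customers y"
    note f = feasibleD [OF pos y, folded x_def L_def c_def]
    note r = reduced_profit_le [OF \<open>c > 0\<close> \<open>s > 1\<close> f(1,3), folded X_def]
    \<comment> \<open>Either the bracket vanishes, or X = 1 and the bracket is nonnegative while x
      is at most 1.\<close>
    have "x * (V * \<Lambda> - (s\<^sup>2 - 1)) \<le> X * (V * \<Lambda> - (s\<^sup>2 - 1))"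
      using slack D f(2) by (auto intro: mult_right_mono)
    with r(1) split [of x L] have le: "reduced_profit (V * \<Lambda>) c x L \<le> P"
      and eq: "reduced_profit (V * \<Lambda>) c x L = P \<Longrightarrow> L = s - 1 \<and> x = X"
      using r(2) unfolding P_def by linarith+
    have "y = z" if "profit y = P"
      using that f(4,5) le eq by (simp add: z_def)
    with f(4) le show ?thesis by auto
  qed
  have opt: "optimal V \<Lambda> K \<mu> y \<longleftrightarrow> feasible V \<Lambda> K \<mu> y \<and> profit y = P" for y
    using bound z_feasible z_profit by (force simp: optimal_def)
  then have opt_z: "optimal V \<Lambda> K \<mu> y \<longleftrightarrow> y = z" for y
    using bound z_feasible z_profit by metis
  have "arrival_rate z = X * \<Lambda>" "avg_customers z = s - 1"
    using pos \<open>X > 0\<close> by (simp_all add: z_def avg_customers_def)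
  then have "optimal V \<Lambda> K \<mu> y \<longleftrightarrow>
      feasible V \<Lambda> K \<mu> y \<and> arrival_rate y = X * \<Lambda> \<and> avg_customers y = s - 1 \<and> profit y = P" for y
    using opt opt_z by metis
  moreover have "optimal_profit V \<Lambda> K \<mu> = P"
    unfolding optimal_profit_def using bound z_feasible z_profit
    by (intro cSup_eq_maximum) auto
  moreover have "\<exists>!x. optimal V \<Lambda> K \<mu> x" using opt_z by simp
  ultimately show ?thesis by blast
qed

section \<open>The equation behind \<open>L_bar\<close>\<close>

text \<open>Clearing denominators leaves a^3 + a^3 b < b^3 + b^3 a, which is compared term by
  term.\<close>

lemma cube_over_Suc_strict_mono:
  fixes a b :: real
  assumes "0 \<le> a" "a < b"
  shows "a ^ 3 / (1 + a) < b ^ 3 / (1 + b)"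
proof -
  have "a ^ 3 < b ^ 3" using assms by (simp add: power_strict_mono)
  moreover have "a ^ 3 * b \<le> b ^ 3 * a"
    using assms mult_left_mono [of "a\<^sup>2" "b\<^sup>2" "a * b"] power_mono [of a b 2]
    by (simp add: power2_eq_square power3_eq_cube algebra_simps)
  ultimately show ?thesis using assms by (simp add: field_simps)
qed

text \<open>The intermediate value theorem gives a root of the equation, and strict monotonicity
  makes it the greatest solution of the defining inequality.\<close>

lemma L_bar_root:
  assumes "\<Lambda> > 0" "K > 0" "\<mu> > 0"
  shows "L_bar \<Lambda> K \<mu> > 0"
    and "L_bar \<Lambda> K \<mu> ^ 3 / (1 + L_bar \<Lambda> K \<mu>) = 2 * \<Lambda>\<^sup>2 / (K * \<mu>\<^sup>2)"
proof -
  define q where "q = 2 * \<Lambda>\<^sup>2 / (K * \<mu>\<^sup>2)"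
  have "q > 0" using assms by (simp add: q_def)
  \<comment> \<open>The point 1 + 2 q is merely a convenient right end where the function has
    reached q.\<close>
  have "q \<le> (1 + 2 * q) ^ 3 / (1 + (1 + 2 * q))"
  proof -
    have "q * (2 + 2 * q) \<le> (1 + 2 * q) ^ 3"
      using \<open>q > 0\<close> by (simp add: power3_eq_cube algebra_simps add_nonneg_nonneg)
    then show ?thesis using \<open>q > 0\<close> by (simp add: field_simps)
  qed
  moreover have "continuous_on {0..1 + 2 * q} (\<lambda>L. L ^ 3 / (1 + L))"
    by (intro continuous_intros) auto
  ultimately obtain m where m: "m \<ge> 0" "m ^ 3 / (1 + m) = q"
    using IVT' [of "\<lambda>L. L ^ 3 / (1 + L)" 0 q "1 + 2 * q"] \<open>q > 0\<close> by auto
  with \<open>q > 0\<close> have "m > 0" by (cases "m = 0") auto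
  have "L_bar \<Lambda> K \<mu> = m"
    unfolding L_bar_def q_def [symmetric]
  proof (rule Greatest_equality)
    show "m > 0 \<and> m ^ 3 / (1 + m) \<le> q" using m \<open>m > 0\<close> by simp
    show "L \<le> m" if "L > 0 \<and> L ^ 3 / (1 + L) \<le> q" for L
      using that m cube_over_Suc_strict_mono [of m L] by force
  qed
  with m \<open>m > 0\<close> show "L_bar \<Lambda> K \<mu> > 0"
    and "L_bar \<Lambda> K \<mu> ^ 3 / (1 + L_bar \<Lambda> K \<mu>) = 2 * \<Lambda>\<^sup>2 / (K * \<mu>\<^sup>2)"
    by (simp_all add: q_def)
qed

section \<open>Specialization to the two ranges of K\<close>

theorem proposition2:
  fixes V \<Lambda> K \<mu> :: real
  assumes "V > 0" and "\<Lambda> > 0" and "K > 0" and "\<mu> > 0"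
  shows "(\<exists>!x. optimal V \<Lambda> K \<mu> x) \<and>
    (K \<ge> K_bar V \<Lambda> \<mu> \<longrightarrow>
       (\<forall>x. optimal V \<Lambda> K \<mu> x \<longleftrightarrow>
          feasible V \<Lambda> K \<mu> x \<and>
          arrival_rate x = \<Lambda> \<and>
          avg_customers x = L_bar \<Lambda> K \<mu> \<and>
          profit x = \<Lambda> * (V - C_bar \<Lambda> K \<mu>)) \<and>
       optimal_profit V \<Lambda> K \<mu> = \<Lambda> * (V - C_bar \<Lambda> K \<mu>)) \<and>
    (\<not> K \<ge> K_bar V \<Lambda> \<mu> \<longrightarrow>
       (\<forall>x. optimal V \<Lambda> K \<mu> x \<longleftrightarrow>
          feasible V \<Lambda> K \<mu> x \<and>
          arrival_rate x = K / K_bar V \<Lambda> \<mu> * \<Lambda> \<and>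
          avg_customers x = sqrt (V * \<Lambda> + 1) - 1 \<and>
          profit x = K * \<mu>\<^sup>2 * (sqrt (V * \<Lambda> + 1) - 1) ^ 4 / (4 * \<Lambda>\<^sup>2)) \<and>
       optimal_profit V \<Lambda> K \<mu> = K * \<mu>\<^sup>2 * (sqrt (V * \<Lambda> + 1) - 1) ^ 4 / (4 * \<Lambda>\<^sup>2))"
proof -
  define s where "s = sqrt (V * \<Lambda> + 1)"
  define c where "c = \<Lambda>\<^sup>2 / (K * \<mu>\<^sup>2)"
  define m where "m = L_bar \<Lambda> K \<mu>"
  have "c > 0" using assms by (simp add: c_def)
  have "s > 1" using assms by (simp add: s_def)
  have s_sq: "s\<^sup>2 - 1 = V * \<Lambda>" using assms by (simp add: s_def)
  \<comment> \<open>The unconstrained optimal fraction is proportional to K and equals 1 exactly at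
    \<open>K_bar\<close>.\<close>
  have K_ratio: "(s - 1) ^ 3 / (2 * c * s) = K / K_bar V \<Lambda> \<mu>"
    unfolding K_bar_def s_def [symmetric] c_def using assms \<open>s > 1\<close> by simp
  have K_bar_pos: "K_bar V \<Lambda> \<mu> > 0"
    unfolding K_bar_def s_def [symmetric] using assms \<open>s > 1\<close> by simp
  show ?thesis
  proof (cases "K \<ge> K_bar V \<Lambda> \<mu>")
    case True
    have "m > 0" and m: "m ^ 3 / (1 + m) = 2 * c"
      using L_bar_root assms(2-4) by (simp_all add: m_def c_def)
    have "1 \<le> (s - 1) ^ 3 / (2 * c * s)" using True K_bar_pos K_ratio by simp
    \<comment> \<open>Both sides are values of the increasing function t^3/(1 + t), so m and s - 1
      can be compared.\<close>
    then have "m ^ 3 / (1 + m) \<le> (s - 1) ^ 3 / (1 + (s - 1))"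
      using \<open>c > 0\<close> \<open>s > 1\<close> by (simp add: m field_simps)
    then have "m \<le> s - 1"
      using cube_over_Suc_strict_mono [of "s - 1" m] \<open>s > 1\<close> by force
    then have "(1 + m)\<^sup>2 \<le> s\<^sup>2" using \<open>m > 0\<close> by (intro power_mono) auto
    then have D: "(1 + m)\<^sup>2 - 1 \<le> V * \<Lambda>" using s_sq by simp
    have "m ^ 3 = 2 * c * (1 + m)" using m \<open>m > 0\<close> by (simp add: field_simps)
    \<comment> \<open>For the parameter 1 + m the unconstrained fraction is exactly 1, the first
      alternative of the slackness condition.\<close>
    then have X: "m ^ 3 / (2 * c * (1 + m)) = 1" using \<open>m > 0\<close> \<open>c > 0\<close> by simp
    have "m ^ 4 / (4 * c) = m * (1 + m) / 2"
    proof -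
      have "m ^ 4 = m * (1 + m) / 2 * (4 * c)"
        using \<open>m ^ 3 = 2 * c * (1 + m)\<close> by (simp add: power_Suc [of m 3, simplified])
      then show ?thesis using \<open>c > 0\<close> by simp
    qed
    \<comment> \<open>The cost appears as (1 + m)^2 - 1 - m (1 + m)/2 = m (3 + m)/2.\<close>
    then have P: "m ^ 4 / (4 * c) + (V * \<Lambda> - ((1 + m)\<^sup>2 - 1)) = \<Lambda> * (V - C_bar \<Lambda> K \<mu>)"
      unfolding C_bar_def m_def [symmetric] using assms(2)
      by (simp add: field_simps power2_eq_square)
    have "1 < 1 + m" using \<open>m > 0\<close> by simp
    note optimal_characterization [OF assms(2-4) this, of V, folded c_def,
        unfolded add_diff_cancel_left' X mult_1 P, OF order_refl D disjI1 [OF refl]]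
    with True show ?thesis unfolding m_def by blast
  next
    case False
    then have X: "K / K_bar V \<Lambda> \<mu> \<le> 1" using K_bar_pos by simp
    have P: "(s - 1) ^ 4 / (4 * c) = K * \<mu>\<^sup>2 * (s - 1) ^ 4 / (4 * \<Lambda>\<^sup>2)"
      by (simp add: c_def)
    \<comment> \<open>Here s^2 - 1 = V \<Lambda>, so the correction term in the optimal value
      vanishes.\<close>
    note optimal_characterization [OF assms(2-4) \<open>s > 1\<close>, of V, folded c_def,
        unfolded s_sq K_ratio P diff_self mult_zero_right add_0_right, OF X order_refl disjI2 [OF refl]]
    with False show ?thesis unfolding s_def by blast
  qed
qed

end
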